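(* Let $\boldsymbol X_1,\ldots,\boldsymbol X_n\in\mathbb R^d$, let $[n]=\{1,\ldots,n\}$, let $$\widetilde{\mathcal Q}:=\{(\psi(\boldsymbol X_1),\ldots,\psi(\boldsymbol X_n)):\ \psi:\mathbb R^d\to\mathbb R\text{ quasiconvex}\}\subseteq\mathbb R^n,$$ and let $\widetilde{\mathcal L}(\mathcal X)$ be the set of all pairs $(i,S)$ with $i\in[n]$, $S\subseteq[n]$ such that $\boldsymbol X_i\in\mathrm{Cv}(\{\boldsymbol X_j:j\in S\})$. Then $$\widetilde{\mathcal Q}=\Big\{\boldsymbol z\in\mathbb R^n:\ z_i\le\max_{j\in S}z_j\ \text{ for all }(i,S)\in\widetilde{\mathcal L}(\mathcal X)\Big\}.$$
   Context: $\psi:\mathbb R^d\to\mathbb R$ is quasiconvex if $\psi(\lambda\boldsymbol x+(1-\lambda)\boldsymbol y)\le\max\{\psi(\boldsymbol x),\psi(\boldsymbol y)\}$ for all $\boldsymbol x,\boldsymbol y\in\mathbb R^d$ and $\lambda\in[0,1]$. $\mathrm{Cv}(A)$ is the convex hull of $A$, with $\mathrm{Cv}(\emptyset)=\emptyset$. *)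

theory Defs
  imports "HOL-Analysis.Analysis"
begin

definition quasiconvex :: "(real ^ 'd \<Rightarrow> real) \<Rightarrow> bool" where
  "quasiconvex \<psi> \<longleftrightarrow>
    (\<forall>x y. \<forall>t\<in>{0..1}. \<psi> (t *\<^sub>R x + (1 - t) *\<^sub>R y) \<le> max (\<psi> x) (\<psi> y))"

text \<open>The index set $[n]$ is the universe of the finite type \<open>'n\<close>, so that the points
  form a family \<open>X\<close>, possibly with repetitions.\<close>

definition quasiconvex_values :: "('n::finite \<Rightarrow> real ^ 'd) \<Rightarrow> (real ^ 'n) set" where
  "quasiconvex_values X = {(\<chi> i. \<psi> (X i)) | \<psi>. quasiconvex \<psi>}"

text \<open>The set of pairs $(i, S)$ such that $X_i$ lies in the convex hull of the $X_j$ with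
  $j \in S$. Since the convex hull of the empty set is empty, no pair has $S = \emptyset$.\<close>

definition hull_pairs :: "('n::finite \<Rightarrow> real ^ 'd) \<Rightarrow> ('n \<times> 'n set) set" where
  "hull_pairs X = {(i, S). X i \<in> convex hull (X ` S)}"

end

theory Submission
  imports Defs
begin

text \<open>Sublevel sets of a quasiconvex function are convex, which gives the inequalities.
  Conversely, given \<open>z\<close>, let \<open>\<psi> x\<close> be the least value \<open>t\<close> of \<open>z\<close> such that \<open>x\<close> lies in the
  convex hull of the points \<open>X j\<close> with \<open>z $ j \<le> t\<close>, and the maximum of \<open>z\<close> if there is none;
  these hulls increase with \<open>t\<close>, so \<open>\<psi>\<close> is quasiconvex, and the inequalities for \<open>z\<close> say
  exactly that \<open>\<psi>\<close> interpolates \<open>z\<close>.\<close>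

lemma quasiconvex_convex_sublevel:
  assumes "quasiconvex \<psi>"
  shows "convex {x. \<psi> x \<le> M}"
proof (rule convexI)
  fix x y and u v :: real
  assume xy: "x \<in> {x. \<psi> x \<le> M}" "y \<in> {x. \<psi> x \<le> M}"
    and uv: "0 \<le> u" "0 \<le> v" "u + v = 1"
  have "\<psi> (u *\<^sub>R x + (1 - u) *\<^sub>R y) \<le> max (\<psi> x) (\<psi> y)"
    using assms uv unfolding quasiconvex_def by auto
  moreover have "v = 1 - u"
    using uv by simp
  ultimately show "u *\<^sub>R x + v *\<^sub>R y \<in> {x. \<psi> x \<le> M}"
    using xy by auto
qed

lemma quasiconvex_le_Max_of_hull:
  fixes X :: "'n::finite \<Rightarrow> real ^ 'd"
  assumes "quasiconvex \<psi>" "x \<in> convex hull (X ` S)"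
  shows "\<psi> x \<le> Max ((\<lambda>j. \<psi> (X j)) ` S)"
proof -
  \<comment> \<open>When \<open>S\<close> is empty the hull is empty too, so the unspecified value
    \<open>Max {}\<close> does no harm.\<close>
  have "convex hull (X ` S) \<subseteq> {x. \<psi> x \<le> Max ((\<lambda>j. \<psi> (X j)) ` S)}"
    by (rule hull_minimal) (auto simp: quasiconvex_convex_sublevel assms(1))
  then show ?thesis
    using assms(2) by auto
qed

text \<open>The inserted maximum keeps the set nonempty, so that \<open>Min\<close> is meaningful.
  It bounds every other member from above, hence changes the minimum only where no hull contains
  \<open>x\<close>.\<close>

definition hull_levels :: "('n::finite \<Rightarrow> real ^ 'd) \<Rightarrow> real ^ 'n \<Rightarrow> real ^ 'd \<Rightarrow> real set" where
  "hull_levels X z x = insert (Max (range (($) z)))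
    {t \<in> range (($) z). x \<in> convex hull (X ` {j. z $ j \<le> t})}"

lemma finite_hull_levels: "finite (hull_levels X z x)"
  unfolding hull_levels_def by simp

lemma Min_hull_levels_in: "Min (hull_levels X z x) \<in> hull_levels X z x"
  by (rule Min_in[OF finite_hull_levels]) (simp add: hull_levels_def)

lemma hull_levels_le_Max: "t \<in> hull_levels X z x \<Longrightarrow> t \<le> Max (range (($) z))"
  unfolding hull_levels_def by auto

lemma quasiconvex_Min_hull_levels:
  "quasiconvex (\<lambda>x. Min (hull_levels X z x))"
  unfolding quasiconvex_def
proof (intro allI ballI)
  fix x y and t :: real
  assume t: "t \<in> {0..1}"
  define a b where "a = Min (hull_levels X z x)" and "b = Min (hull_levels X z y)"
  let ?w = "t *\<^sub>R x + (1 - t) *\<^sub>R y"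
  let ?H = "\<lambda>s. convex hull (X ` {j. z $ j \<le> s})"
  have ab: "a \<in> hull_levels X z x" "b \<in> hull_levels X z y"
    unfolding a_def b_def by (rule Min_hull_levels_in)+
  have "max a b \<in> hull_levels X z ?w"
  \<comment> \<open>The top level belongs to every level set by fiat. Below it, neither
    \<open>a\<close> nor \<open>b\<close> is the inserted default, so both come with an actual hull
    membership.\<close>
  proof (cases "max a b = Max (range (($) z))")
    case True
    then show ?thesis unfolding hull_levels_def by simp
  next
    case False
    then have "a \<noteq> Max (range (($) z))" "b \<noteq> Max (range (($) z))"
      using hull_levels_le_Max[OF ab(1)] hull_levels_le_Max[OF ab(2)] by auto
    then have a: "a \<in> range (($) z)" "x \<in> ?H a" and b: "b \<in> range (($) z)" "y \<in> ?H b"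
      using ab unfolding hull_levels_def by auto
    have "?H a \<subseteq> ?H (max a b)" "?H b \<subseteq> ?H (max a b)"
      by (auto intro!: hull_mono image_mono)
    then have "?w \<in> ?H (max a b)"
      using a b t by (intro convexD[OF convex_convex_hull]) auto
    moreover have "max a b \<in> range (($) z)"
      using a b by (simp add: max_def)
    ultimately show ?thesis unfolding hull_levels_def by simp
  qed
  then show "Min (hull_levels X z ?w) \<le> max (Min (hull_levels X z x)) (Min (hull_levels X z y))"
    unfolding a_def b_def by (rule Min_le[OF finite_hull_levels])
qed

lemma Min_hull_levels_eq:
  assumes z: "\<forall>(i, S) \<in> hull_pairs X. z $ i \<le> Max ((\<lambda>j. z $ j) ` S)"
  shows "Min (hull_levels X z (X i)) = z $ i"
proof (rule Min_eqI[OF finite_hull_levels])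
  \<comment> \<open>\<open>X i\<close> is itself one of the points spanning the hull at level
    \<open>z $ i\<close>.\<close>
  show "z $ i \<in> hull_levels X z (X i)"
    unfolding hull_levels_def by (auto intro!: hull_inc)
next
  fix t
  assume "t \<in> hull_levels X z (X i)"
  then consider "t = Max (range (($) z))" | "X i \<in> convex hull (X ` {j. z $ j \<le> t})"
    unfolding hull_levels_def by auto
  then show "z $ i \<le> t"
  proof cases
    case 1
    then show ?thesis by simp
  next
    case 2
    \<comment> \<open>The hypothesis is used for the sublevel index set
      \<open>S = {j. z $ j \<le> t}\<close>.\<close>
    then have "z $ i \<le> Max ((\<lambda>j. z $ j) ` {j. z $ j \<le> t})"
      using z unfolding hull_pairs_def by auto
    \<comment> \<open>Nonemptiness is what allows \<open>Max\<close> to be bounded elementwise by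
      \<open>t\<close>.\<close>
    also have "{j. z $ j \<le> t} \<noteq> {}"
      using 2 by (metis convex_hull_empty empty_iff image_empty)
    then have "Max ((\<lambda>j. z $ j) ` {j. z $ j \<le> t}) \<le> t"
      by (subst Max_le_iff) auto
    finally show ?thesis .
  qed
qed

theorem lemma4p2:
  fixes X :: "'n::finite \<Rightarrow> real ^ 'd"
  shows "quasiconvex_values X =
    {z :: real ^ 'n. \<forall>(i, S) \<in> hull_pairs X. z $ i \<le> Max ((\<lambda>j. z $ j) ` S)}"
proof (intro subset_antisym subsetI)
  fix z :: "real ^ 'n"
  assume "z \<in> quasiconvex_values X"
  then obtain \<psi> where "quasiconvex \<psi>" "z = (\<chi> i. \<psi> (X i))"
    unfolding quasiconvex_values_def by blast
  then show "z \<in> {z. \<forall>(i, S) \<in> hull_pairs X. z $ i \<le> Max ((\<lambda>j. z $ j) ` S)}"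
    by (auto simp: hull_pairs_def intro: quasiconvex_le_Max_of_hull)
next
  fix z :: "real ^ 'n"
  assume "z \<in> {z. \<forall>(i, S) \<in> hull_pairs X. z $ i \<le> Max ((\<lambda>j. z $ j) ` S)}"
  then have "z = (\<chi> i. Min (hull_levels X z (X i)))"
    by (simp add: vec_eq_iff Min_hull_levels_eq)
  then show "z \<in> quasiconvex_values X"
    unfolding quasiconvex_values_def mem_Collect_eq
    using quasiconvex_Min_hull_levels[of X z]
    by (intro exI[of _ "\<lambda>x. Min (hull_levels X z x)"] conjI)
qed

end
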